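(* Let $\delta\in(0,1)$ and, for $\lambda\in\mathbb{C}$, let $$\mathcal{N}_\lambda=\#\left\{\xi=(\xi_1,\xi_2)\in\mathbb{Z}^2:\ |\xi_1^2+i\xi_2^2-\lambda|\le|\xi|^{1+\delta}\right\},$$ which is the lattice point count associated with the operator $H=-\partial_x^2-i\partial_y^2$ on $\mathbb{R}^2$. Then there are constants $C,\Lambda>0$ depending only on $\delta$ such that: (i) for all $\lambda$ with $0<\operatorname{Im}\lambda\le\operatorname{Re}\lambda$ and $\operatorname{Re}\lambda\ge\Lambda$, $$\mathcal{N}_\lambda\le C\begin{cases}(\operatorname{Re}\lambda)^{1/2+\delta}(\operatorname{Im}\lambda)^{-1/2}&\text{if }(\operatorname{Re}\lambda)^{1/2}\le\operatorname{Im}\lambda\le\operatorname{Re}\lambda,\\(\operatorname{Re}\lambda)^{1/4+\delta}&\text{if }\operatorname{Im}\lambda\le(\operatorname{Re}\lambda)^{1/2};\end{cases}$$ (ii) for all $\lambda$ with $0<\operatorname{Re}\lambda\le\operatorname{Im}\lambda$ and $\operatorname{Im}\lambda\ge\Lambda$, the same bounds hold with $\operatorname{Re}\lambda$ and $\operatorname{Im}\lambda$ exchanged.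
   Context: The symbol of $H=-\partial_x^2-i\partial_y^2$ is $P(\xi)=\xi_1^2+i\xi_2^2$. $|\xi|=(\xi_1^2+\xi_2^2)^{1/2}$ is the Euclidean norm. *)

theory Defs
  imports "HOL-Analysis.Analysis"
begin

(* Symbol of H = - (d/dx)^2 - i (d/dy)^2, each derivative d/dx_j contributing i xi_j. *)
definition symbol_H :: "real \<times> real \<Rightarrow> complex" where
  "symbol_H \<xi> = complex_of_real ((fst \<xi>)\<^sup>2) + \<i> * complex_of_real ((snd \<xi>)\<^sup>2)"

(* The norm on real \<times> real is the Euclidean one (norm_Pair). *)
definition lattice_set :: "real \<Rightarrow> complex \<Rightarrow> (int \<times> int) set" where
  "lattice_set \<delta> z =
     {(m, n). cmod (symbol_H (real_of_int m, real_of_int n) - z)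
                \<le> norm (real_of_int m, real_of_int n) powr (1 + \<delta>)}"

(* Since card is 0 on infinite sets, an upper bound on this number is only meaningful
   together with finiteness of lattice_set. *)
definition lattice_count :: "real \<Rightarrow> complex \<Rightarrow> nat" where
  "lattice_count \<delta> z = card (lattice_set \<delta> z)"

end

theory Submission
  imports Defs
begin

text \<open>
  Write \<open>z = a + i b\<close>. The symbol is elliptic of order two, in the sense that
  \<open>\<bar>\<xi>\<bar>\<^sup>2 \<le> 2 \<bar>P \<xi>\<bar>\<close>, while the tolerance \<open>\<bar>\<xi>\<bar> powr (1 + \<delta>)\<close> is of lower order because
  \<open>\<delta> < 1\<close>. Hence, once \<open>M = max a b\<close> is large, every counted \<open>\<xi>\<close> satisfies \<open>\<bar>\<xi>\<bar>\<^sup>2 \<le> 8 M\<close>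
  (lemma \<open>lattice_set_norm_bound\<close>), and the tolerance may be replaced by the fixed radius
  \<open>R = 8 M powr ((1 + \<delta>)/2)\<close>. Comparing real and imaginary parts, the lattice set is then
  contained in a product of two sets of integers whose squares lie within \<open>R\<close> of \<open>a\<close> and of
  \<open>b\<close> (lemma \<open>lattice_set_subset_Times\<close>).

  The integers with square within \<open>R\<close> of \<open>c\<close> can be counted in two ways. As the square root has
  derivative of size \<open>1 / sqrt c\<close>, there are \<open>O(R / sqrt c + 1)\<close> of them, which is the sharper
  count away from the origin; and there are trivially \<open>O(sqrt (c + R) + 1)\<close> of them, which is the
  better one when \<open>c\<close> is small. Let \<open>b \<le> a\<close>. The first count gives \<open>O(a powr (\<delta>/2))\<close> for the
  coordinate attached to \<open>a\<close>. For the one attached to \<open>b\<close> the first count gives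
  \<open>O(a powr (1/2 + \<delta>/2) * b powr (-1/2))\<close>, and if \<open>b \<le> sqrt a\<close> the second gives
  \<open>O(a powr (1/4 + \<delta>/4))\<close>. Multiplying yields both cases of the theorem. Since only the product
  of the two counts enters, exchanging the real and imaginary parts changes nothing.
\<close>

definition ints_square_near :: "real \<Rightarrow> real \<Rightarrow> int set" where
  "ints_square_near c R = {n. \<bar>(real_of_int n)\<^sup>2 - c\<bar> \<le> R}"

lemma card_ints_in_interval:
  fixes r c :: real
  assumes "r \<ge> 0"
  shows "finite {n::int. c - r \<le> n \<and> n \<le> c + r}"
    and "real (card {n::int. c - r \<le> n \<and> n \<le> c + r}) \<le> 2 * r + 1"
proof -
  have eq: "{n::int. c - r \<le> n \<and> n \<le> c + r} = {\<lceil>c - r\<rceil>..\<lfloor>c + r\<rfloor>}"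
    by (auto simp: ceiling_le_iff le_floor_iff)
  show "finite {n::int. c - r \<le> n \<and> n \<le> c + r}"
    unfolding eq by simp
  show "real (card {n::int. c - r \<le> n \<and> n \<le> c + r}) \<le> 2 * r + 1"
    unfolding eq using assms by simp linarith
qed

text \<open>The factorisation \<open>n\<^sup>2 - c = (\<bar>n\<bar> - sqrt c) (\<bar>n\<bar> + sqrt c)\<close> confines \<open>n\<close> to
  two intervals of radius \<open>R / sqrt c\<close> around \<open>sqrt c\<close> and \<open>- sqrt c\<close>.\<close>

lemma card_ints_square_near:
  assumes "c > 0" "R \<ge> 0"
  shows "finite (ints_square_near c R)"
    and "real (card (ints_square_near c R)) \<le> 4 * (R / sqrt c) + 2"
proof -
  define r where "r = R / sqrt c"
  define I where "I s = {n::int. s - r \<le> n \<and> n \<le> s + r}" for s :: real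
  have r: "r \<ge> 0" using assms by (simp add: r_def)
  have I: "finite (I s)" "real (card (I s)) \<le> 2 * r + 1" for s
    unfolding I_def using card_ints_in_interval[OF r] by auto
  have sub: "ints_square_near c R \<subseteq> I (sqrt c) \<union> I (- sqrt c)"
  proof
    fix n assume "n \<in> ints_square_near c R"
    then have n: "\<bar>(real_of_int n)\<^sup>2 - c\<bar> \<le> R" by (simp add: ints_square_near_def)
    have "(real_of_int n)\<^sup>2 - c = (\<bar>real_of_int n\<bar> - sqrt c) * (\<bar>real_of_int n\<bar> + sqrt c)"
      using assms by (simp add: algebra_simps power2_eq_square)
    then have "\<bar>\<bar>real_of_int n\<bar> - sqrt c\<bar> * (\<bar>real_of_int n\<bar> + sqrt c) \<le> R"
      using n assms by (simp add: abs_mult)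
    moreover have "\<bar>\<bar>real_of_int n\<bar> - sqrt c\<bar> * sqrt c
        \<le> \<bar>\<bar>real_of_int n\<bar> - sqrt c\<bar> * (\<bar>real_of_int n\<bar> + sqrt c)"
      by (intro mult_left_mono) auto
    ultimately have "\<bar>\<bar>real_of_int n\<bar> - sqrt c\<bar> \<le> r"
      using assms by (simp add: r_def pos_le_divide_eq)
    then show "n \<in> I (sqrt c) \<union> I (- sqrt c)"
      by (auto simp: I_def abs_le_iff split: abs_split)
  qed
  show "finite (ints_square_near c R)"
    using sub I(1) by (meson finite_UnI finite_subset)
  have "card (ints_square_near c R) \<le> card (I (sqrt c)) + card (I (- sqrt c))"
    using card_mono[OF _ sub] I(1) card_Un_le[of "I (sqrt c)" "I (- sqrt c)"]
    by (meson finite_UnI le_trans)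
  then show "real (card (ints_square_near c R)) \<le> 4 * (R / sqrt c) + 2"
    using I(2)[of "sqrt c"] I(2)[of "- sqrt c"] unfolding r_def by linarith
qed

lemma card_ints_square_near_le_sqrt:
  assumes "c + R \<ge> 0"
  shows "real (card (ints_square_near c R)) \<le> 2 * sqrt (c + R) + 1"
proof -
  have sub: "ints_square_near c R \<subseteq> {n::int. 0 - sqrt (c + R) \<le> n \<and> n \<le> 0 + sqrt (c + R)}"
  proof
    fix n assume "n \<in> ints_square_near c R"
    then have "(real_of_int n)\<^sup>2 \<le> c + R" by (auto simp: ints_square_near_def)
    then have "\<bar>real_of_int n\<bar> \<le> sqrt (c + R)" using real_le_rsqrt by fastforce
    then show "n \<in> {n::int. 0 - sqrt (c + R) \<le> n \<and> n \<le> 0 + sqrt (c + R)}" by auto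
  qed
  have s: "sqrt (c + R) \<ge> 0" using assms by simp
  show ?thesis
    using card_mono[OF card_ints_in_interval(1)[OF s] sub] card_ints_in_interval(2)[OF s, of 0]
    by linarith
qed

lemma power2_norm_le_cmod_symbol_H: "(norm \<xi>)\<^sup>2 \<le> 2 * cmod (symbol_H \<xi>)"
proof -
  have "(norm \<xi>)\<^sup>2 = (fst \<xi>)\<^sup>2 + (snd \<xi>)\<^sup>2"
    by (simp add: norm_prod_def)
  moreover have "(fst \<xi>)\<^sup>2 \<le> cmod (symbol_H \<xi>)" "(snd \<xi>)\<^sup>2 \<le> cmod (symbol_H \<xi>)"
    using abs_Re_le_cmod[of "symbol_H \<xi>"] abs_Im_le_cmod[of "symbol_H \<xi>"]
    by (auto simp: symbol_H_def)
  ultimately show ?thesis by linarith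
qed

text \<open>Ellipticity gives \<open>t\<^sup>2 \<le> 4 M + 2 t powr (1 + \<delta>)\<close> for \<open>t = \<bar>\<xi>\<bar>\<close>. If \<open>t powr (1 - \<delta>) \<ge> 4\<close>,
  the last term is at most \<open>t\<^sup>2 / 2\<close> and can be absorbed; otherwise \<open>t\<^sup>2\<close> is below the threshold
  imposed on \<open>M\<close>.\<close>

lemma lattice_set_norm_bound:
  assumes d: "\<delta> < 1"
    and M: "16 powr (1 / (1 - \<delta>)) \<le> M" "\<bar>Re z\<bar> \<le> M" "\<bar>Im z\<bar> \<le> M"
    and mn: "(m, n) \<in> lattice_set \<delta> z"
  shows "(norm (real_of_int m, real_of_int n))\<^sup>2 \<le> 8 * M"
proof -
  define t where "t = norm (real_of_int m, real_of_int n)"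
  have t0: "t \<ge> 0" by (simp add: t_def)
  have "cmod (symbol_H (real_of_int m, real_of_int n)) \<le> cmod z + t powr (1 + \<delta>)"
    using mn norm_triangle_sub[of "symbol_H (real_of_int m, real_of_int n)" z]
    by (simp add: lattice_set_def t_def)
  moreover have "cmod z \<le> 2 * M"
    using cmod_le[of z] M by linarith
  ultimately have ell: "t\<^sup>2 \<le> 4 * M + 2 * t powr (1 + \<delta>)"
    using power2_norm_le_cmod_symbol_H[of "(real_of_int m, real_of_int n)"]
    unfolding t_def by linarith
  have "t\<^sup>2 \<le> 8 * M"
  proof (cases "t powr (1 - \<delta>) \<ge> 4")
    case True
    then have t: "t > 0" using t0 by (cases "t = 0") auto
    have "t powr (1 + \<delta>) * t powr (1 - \<delta>) = t\<^sup>2"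
      using t by (simp flip: powr_add)
    moreover have "t powr (1 + \<delta>) * 4 \<le> t powr (1 + \<delta>) * t powr (1 - \<delta>)"
      by (intro mult_left_mono True) auto
    ultimately show ?thesis using ell by linarith
  next
    case False
    have "t = (t powr (1 - \<delta>)) powr (1 / (1 - \<delta>))"
      using d t0 by (simp add: powr_powr)
    also have "\<dots> \<le> 4 powr (1 / (1 - \<delta>))"
      using False d by (intro powr_mono2) auto
    finally have "t\<^sup>2 \<le> (4 powr (1 / (1 - \<delta>)))\<^sup>2"
      using t0 by (intro power_mono) auto
    also have "\<dots> = 16 powr (1 / (1 - \<delta>))"
      by (simp add: power2_eq_square flip: powr_mult)
    moreover have "0 \<le> M"
      using M(2) by linarith
    ultimately show ?thesis using M(1) by linarith
  qed
  then show ?thesis by (simp add: t_def)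
qed

lemma lattice_set_subset_Times:
  assumes d: "0 < \<delta>" "\<delta> < 1"
    and M: "16 powr (1 / (1 - \<delta>)) \<le> M" "\<bar>Re z\<bar> \<le> M" "\<bar>Im z\<bar> \<le> M"
  defines "R \<equiv> 8 * M powr ((1 + \<delta>) / 2)"
  shows "lattice_set \<delta> z \<subseteq> ints_square_near (Re z) R \<times> ints_square_near (Im z) R"
proof clarify
  fix m n assume mn: "(m, n) \<in> lattice_set \<delta> z"
  define t where "t = norm (real_of_int m, real_of_int n)"
  define w where "w = symbol_H (real_of_int m, real_of_int n) - z"
  have M0: "M \<ge> 0" using M(2) by linarith
  have "t \<le> sqrt (8 * M)"
    using lattice_set_norm_bound[OF d(2) M mn] unfolding t_def by (rule real_le_rsqrt)
  then have "t powr (1 + \<delta>) \<le> sqrt (8 * M) powr (1 + \<delta>)"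
    using d by (intro powr_mono2) (auto simp: t_def)
  also have "\<dots> = (8 * M) powr ((1 + \<delta>) / 2)"
    using M0 by (simp add: powr_half_sqrt[symmetric] powr_powr)
  also have "\<dots> = 8 powr ((1 + \<delta>) / 2) * M powr ((1 + \<delta>) / 2)"
    using M0 by (simp add: powr_mult)
  also have "\<dots> \<le> 8 powr 1 * M powr ((1 + \<delta>) / 2)"
    using d by (intro mult_right_mono powr_mono) auto
  finally have "cmod w \<le> R"
    using mn by (simp add: lattice_set_def w_def t_def R_def)
  then have "\<bar>Re w\<bar> \<le> R" "\<bar>Im w\<bar> \<le> R"
    using abs_Re_le_cmod[of w] abs_Im_le_cmod[of w] by linarith+
  then show "m \<in> ints_square_near (Re z) R \<and> n \<in> ints_square_near (Im z) R"
    by (auto simp: ints_square_near_def w_def symbol_H_def)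
qed

lemma card_product_ints_square_near:
  assumes d: "0 < \<delta>" and a: "1 \<le> a" and b: "0 < b" "b \<le> a"
  defines "R \<equiv> 8 * a powr ((1 + \<delta>) / 2)"
  defines "N \<equiv> real (card (ints_square_near a R)) * real (card (ints_square_near b R))"
  shows "N \<le> 1156 * (a powr (1/2 + \<delta>) * b powr (-1/2))"
    and "b \<le> a powr (1/2) \<Longrightarrow> N \<le> 1156 * a powr (1/4 + \<delta>)"
proof -
  have R: "R \<ge> 0" by (simp add: R_def)
  have div: "R / sqrt c = 8 * (a powr (1/2 + \<delta>/2) * c powr (-1/2))" if "c > 0" for c
  proof -
    have "c powr (-1/2) = 1 / sqrt c"
      using that powr_minus_divide[of c "1/2"] by (simp add: powr_half_sqrt)
    then show ?thesis by (simp add: R_def add_divide_distrib)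
  qed
  have "a powr (1/2 + \<delta>/2) * a powr (-1/2) = a powr (\<delta>/2)"
    using a by (simp flip: powr_add)
  moreover have one: "1 \<le> a powr (\<delta>/2)"
    using a d by (intro ge_one_powr_ge_zero) auto
  ultimately have A: "real (card (ints_square_near a R)) \<le> 34 * a powr (\<delta>/2)"
    using card_ints_square_near(2)[of a R] R a div[of a] by auto
  have B: "real (card (ints_square_near b R)) \<le> 34 * (a powr (1/2 + \<delta>/2) * b powr (-1/2))"
  proof -
    \<comment> \<open>The additive constant of the count is absorbed because \<open>b \<le> a\<close>.\<close>
    have "1 \<le> a powr (1/2 + \<delta>/2) * a powr (-1/2)"
      using one a by (simp flip: powr_add)
    also have "\<dots> \<le> a powr (1/2 + \<delta>/2) * b powr (-1/2)"
      using b by (intro mult_left_mono powr_mono2') auto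
    finally show ?thesis
      using card_ints_square_near(2)[of b R] R b div[of b] by auto
  qed
  have "N \<le> (34 * a powr (\<delta>/2)) * (34 * (a powr (1/2 + \<delta>/2) * b powr (-1/2)))"
    unfolding N_def by (intro mult_mono A B) auto
  also have "\<dots> = 1156 * ((a powr (\<delta>/2) * a powr (1/2 + \<delta>/2)) * b powr (-1/2))"
    by (simp add: ac_simps)
  also have "a powr (\<delta>/2) * a powr (1/2 + \<delta>/2) = a powr (1/2 + \<delta>)"
    by (simp add: add.commute flip: powr_add)
  finally show "N \<le> 1156 * (a powr (1/2 + \<delta>) * b powr (-1/2))" .

  assume small: "b \<le> a powr (1/2)"
  have "a powr (1/2) \<le> a powr ((1 + \<delta>)/2)"
    using a d by (intro powr_mono) auto
  then have "b + R \<le> 9 * a powr ((1 + \<delta>)/2)"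
    using small by (simp add: R_def)
  then have "sqrt (b + R) \<le> sqrt (9 * a powr ((1 + \<delta>)/2))"
    by simp
  also have "sqrt (9 * a powr ((1 + \<delta>)/2)) = 3 * a powr ((1 + \<delta>)/4)"
    by (simp add: real_sqrt_mult powr_half_sqrt[symmetric] powr_powr)
  finally have "sqrt (b + R) \<le> 3 * a powr ((1 + \<delta>)/4)" .
  moreover have "1 \<le> a powr ((1 + \<delta>)/4)"
    using a d by (intro ge_one_powr_ge_zero) auto
  ultimately have B': "real (card (ints_square_near b R)) \<le> 34 * a powr ((1 + \<delta>)/4)"
    using card_ints_square_near_le_sqrt[of b R] R b by linarith
  have "N \<le> (34 * a powr (\<delta>/2)) * (34 * a powr ((1 + \<delta>)/4))"
    unfolding N_def by (intro mult_mono A B') auto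
  also have "\<dots> = 1156 * a powr (\<delta>/2 + (1 + \<delta>)/4)"
    by (simp add: powr_add)
  also have "\<dots> \<le> 1156 * a powr (1/4 + \<delta>)"
    using a d by (intro mult_left_mono powr_mono) (auto simp: field_simps)
  finally show "N \<le> 1156 * a powr (1/4 + \<delta>)" .
qed

theorem lemma7:
  fixes \<delta> :: real
  assumes "0 < \<delta>" and "\<delta> < 1"
  shows "\<exists>C \<Lambda> :: real. C > 0 \<and> \<Lambda> > 0 \<and>
    (\<forall>z :: complex. 0 < Im z \<and> Im z \<le> Re z \<and> \<Lambda> \<le> Re z \<longrightarrow>
       finite (lattice_set \<delta> z) \<and>
       (Re z powr (1/2) \<le> Im z \<longrightarrow>
          real (lattice_count \<delta> z) \<le> C * (Re z powr (1/2 + \<delta>) * Im z powr (-1/2))) \<and>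
       (Im z \<le> Re z powr (1/2) \<longrightarrow>
          real (lattice_count \<delta> z) \<le> C * Re z powr (1/4 + \<delta>))) \<and>
    (\<forall>z :: complex. 0 < Re z \<and> Re z \<le> Im z \<and> \<Lambda> \<le> Im z \<longrightarrow>
       finite (lattice_set \<delta> z) \<and>
       (Im z powr (1/2) \<le> Re z \<longrightarrow>
          real (lattice_count \<delta> z) \<le> C * (Im z powr (1/2 + \<delta>) * Re z powr (-1/2))) \<and>
       (Re z \<le> Im z powr (1/2) \<longrightarrow>
          real (lattice_count \<delta> z) \<le> C * Im z powr (1/4 + \<delta>)))"
proof -
  define \<Lambda> where "\<Lambda> = (16::real) powr (1 / (1 - \<delta>))"
  have \<Lambda>: "1 \<le> \<Lambda>"
    unfolding \<Lambda>_def using assms by (intro ge_one_powr_ge_zero) auto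
  have count: "finite (lattice_set \<delta> z) \<and> real (lattice_count \<delta> z)
      \<le> real (card (ints_square_near (Re z) (8 * M powr ((1 + \<delta>) / 2))))
        * real (card (ints_square_near (Im z) (8 * M powr ((1 + \<delta>) / 2))))"
    if "0 < Re z" "0 < Im z" "Re z \<le> M" "Im z \<le> M" "\<Lambda> \<le> M" for z M
  proof -
    define R where "R = 8 * M powr ((1 + \<delta>) / 2)"
    have sub: "lattice_set \<delta> z \<subseteq> ints_square_near (Re z) R \<times> ints_square_near (Im z) R"
      unfolding R_def using that assms by (intro lattice_set_subset_Times) (auto simp: \<Lambda>_def)
    have fin: "finite (ints_square_near (Re z) R \<times> ints_square_near (Im z) R)"
      using that by (intro finite_cartesian_product card_ints_square_near(1)) (auto simp: R_def)
    have "card (lattice_set \<delta> z) \<le> card (ints_square_near (Re z) R) * card (ints_square_near (Im z) R)"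
      using card_mono[OF fin sub] by (simp add: card_cartesian_product)
    then show ?thesis
      using finite_subset[OF sub fin]
      unfolding lattice_count_def R_def[symmetric] of_nat_mult[symmetric] of_nat_le_iff by simp
  qed
  show ?thesis
  proof (rule exI[of _ 1156], rule exI[of _ \<Lambda>], intro conjI allI impI; (elim conjE)?)
    fix z assume z: "0 < Im z" "Im z \<le> Re z" "\<Lambda> \<le> Re z"
    have c: "finite (lattice_set \<delta> z) \<and> real (lattice_count \<delta> z)
      \<le> real (card (ints_square_near (Re z) (8 * Re z powr ((1 + \<delta>) / 2))))
        * real (card (ints_square_near (Im z) (8 * Re z powr ((1 + \<delta>) / 2))))"
      using z \<Lambda> by (intro count) auto
    note p = card_product_ints_square_near[OF assms(1) order_trans[OF \<Lambda> z(3)] z(1,2)]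
    show "finite (lattice_set \<delta> z)" using c by blast
    show "real (lattice_count \<delta> z) \<le> 1156 * (Re z powr (1/2 + \<delta>) * Im z powr (-1/2))"
      using c p(1) by (blast intro: order_trans)
    show "real (lattice_count \<delta> z) \<le> 1156 * Re z powr (1/4 + \<delta>)"
      if "Im z \<le> Re z powr (1/2)"
      using c p(2)[OF that] by (blast intro: order_trans)
  next
    fix z assume z: "0 < Re z" "Re z \<le> Im z" "\<Lambda> \<le> Im z"
    have c: "finite (lattice_set \<delta> z) \<and> real (lattice_count \<delta> z)
      \<le> real (card (ints_square_near (Im z) (8 * Im z powr ((1 + \<delta>) / 2))))
        * real (card (ints_square_near (Re z) (8 * Im z powr ((1 + \<delta>) / 2))))"
      using z \<Lambda> count[of z "Im z"] by (simp add: mult.commute)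
    note p = card_product_ints_square_near[OF assms(1) order_trans[OF \<Lambda> z(3)] z(1,2)]
    show "finite (lattice_set \<delta> z)" using c by blast
    show "real (lattice_count \<delta> z) \<le> 1156 * (Im z powr (1/2 + \<delta>) * Re z powr (-1/2))"
      using c p(1) by (blast intro: order_trans)
    show "real (lattice_count \<delta> z) \<le> 1156 * Im z powr (1/4 + \<delta>)"
      if "Re z \<le> Im z powr (1/2)"
      using c p(2)[OF that] by (blast intro: order_trans)
  qed (use \<Lambda> in auto)
qed

end
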